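(* Assume (C1): $H:P(E\times S)\to\mathbb{R}$ is upper semicontinuous, i.e. $\limsup_{k\to\infty}H(F_{(k)})\le H(F)$ for any sequence $(F_{(k)})$ converging to $F$ in $P(E\times S)$, i.e. $F_{(k)}(x,s)\to F(x,s)$ for every $(x,s)\in E\times S$. For $F\in P(E\times S)$ define recursively $$J_N(F):=H(F),\qquad J_n(F):=\sup_{\pi\in\Pi^M}J_{n+1}(T^\pi(F)),\quad n=0,1,\ldots,N-1.\qquad( * )$$ a) If $(J_n)$ is computed according to $( * )$, then $J_0(F_0)$ is the value function of the problem $\sup_{\sigma\in\Pi_N}H(F_N^\sigma)$, i.e. $J_0(F_0)=\sup_{\sigma\in\Pi_N}H(F_N^\sigma)$. b) Maximizers $(f_0^*,\ldots,f_{N-1}^* )$ in the recursion $( * )$ exist, i.e. for $n=0,1,\ldots,N-1$ $$f_n^*(F)=\operatorname*{argmax}_{\pi}J_{n+1}(T^\pi(F)),\qquad F\in P(E\times S).$$ c) Define the following state-action sequence starting with state $F_0$: $\pi_0^*=f_0^*(F_0)$, $F_1=T^{\pi_0^*}(F_0)$, and in general $\pi_n^*=f_n^*(F_n)$, $F_{n+1}=T^{\pi_n^*}\circ\cdots\circ T^{\pi_0^*}(F_0)$. Then $(\pi_0^*,\pi_1^*,\ldots,\pi_{N-1}^* )$ determines an optimal policy $(\sigma_0^*,\ldots,\sigma_{N-1}^* )$ for the problem $\sup_{\sigma\in\Pi_N}H(F_N^\sigma)$ as follows: $$\sigma_n^*(a|h_n)=\pi_n^*\Big(a\,\Big|\,x_n,\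 \sum_{k=0}^{n-1}r(x_k,a_k)\Big),\qquad n=0,1,\ldots,N-1,$$ where $h_n=(x_0,a_0,\ldots,x_n)$.
   Context: Original MDP with finite horizon $N\in\mathbb{N}$: $E$ is a finite state space, $A$ a finite action space, $r:E\times A\to\mathbb{R}$ the one-stage reward, $q$ the transition probability from $E\times A$ to $E$, $g:E\to\mathbb{R}$ the terminal reward. $P(Y)$ denotes the set of all probability distributions on $Y$. The initial distribution $\nu$ on $E$ is fixed. Histories: $H_0=E$, $H_n=E\times(A\times E)^n$ with elements $h_n=(x_0,a_0,\ldots,x_n)$; $\Omega=E\times(A\times E)^N$; $X_n$ and $A_n$ are the state and action coordinate random variables on $\Omega$. A policy $\sigma=(\sigma_n)_{n=0}^{N-1}$ is a sequence of history-dependent decision rules, $\sigma_n(\cdot|h_n)$ being a probability distribution on $A$ for each $h_n\in H_n$; $\Pi_N$ is the set of all policies. $\sigma$, $\nu$ and $q$ induce the probability measure on $\Omega$ $$\mathbb{P}_\nu^\sigma(X_0=x_0,A_0=a_0,\ldots,X_N=x_N)=\nu(x_0)\sigma_0(a_0|x_0)q(x_1|x_0,a_0)\cdots\sigma_{N-1}(a_{N-1}|h_{N-1})q(x_N|x_{N-1},a_{N-1}).$$ Accumulated rewards: $R_n=\sum_{k=0}^n r(X_k,A_k)$ for $n=0,\ldots,N-1$ and $R_N=\sum_{k=0}^{N-1}r(X_k,A_k)+g(X_N)$. $S$ is the finite set of all possible realizations of $R_0,R_1,\ldots,R_N$. For $\sigma\in\Pi_N$ and $n\ge1$, $F_n^\sigma(x,s)=\mathbb{P}_\nu^\sigma(X_n=x,R_{n-1}=s)$,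 $(x,s)\in E\times S$, is the joint distribution of $(X_n,R_{n-1})$. Lifted MDP (a deterministic control problem): the state space is $P(E\times S)$, where a state $F_n$ at time $n$ is interpreted as the joint distribution of $(X_n,R_{n-1})$; the action space is $\Pi^M=\{\pi:E\times S\to P(A)\}$, written $\pi(a|x,s)$; the one-stage reward is zero; the terminal reward is $H$; the transition function $T:P(E\times S)\times\Pi^M\to P(E\times S)$ is $$T^\pi(F)(x',s')=T(F,\pi)(x',s')=\sum_{(x,s,a):\ r(x,a)=s'-s}q(x'|x,a)\,\pi(a|x,s)\,F(x,s),\qquad (x',s')\in E\times S.$$ The initial state is $F_0=\nu\otimes\delta_0$ (product measure, $\delta_0$ the point mass at $0$).
   Formalization: T need not map P(E×S) into itself, so J_n and the maximizers f_n* in (b) are claimed only for those F in P(E×S) from which every choice of actions at times n,…,N−1 stays in P(E×S); and 0 is added to S so that F_0 lies in P(E×S). *)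

theory Defs
  imports "HOL-Probability.Probability"
begin

text \<open>
  The finite state and action spaces are types \<open>'e\<close>, \<open>'a\<close> of class \<open>finite\<close>; \<open>P(Y)\<close> is \<open>Y pmf\<close>.
  The transition law \<open>q(x'|x,a)\<close> is \<open>pmf (q x a) x'\<close> and \<open>\<pi>(a|x,s)\<close> is \<open>pmf (\<pi> x s) a\<close>.
\<close>

section \<open>The original decision process\<close>

text \<open>
  A history \<open>(x\<^sub>0, a\<^sub>0, x\<^sub>1, \<dots>, a\<^sub>n\<^sub>-\<^sub>1, x\<^sub>n)\<close> is the pair \<open>(x\<^sub>0, [(a\<^sub>0, x\<^sub>1), \<dots>, (a\<^sub>n\<^sub>-\<^sub>1, x\<^sub>n)])\<close>, so that
  \<open>H\<^sub>n\<close> is \<open>histories n\<close> and \<open>\<Omega>\<close> is \<open>histories N\<close>.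
\<close>

type_synonym ('e, 'a) history = "'e \<times> ('a \<times> 'e) list"

definition histories :: "nat \<Rightarrow> ('e, 'a) history set" where
  "histories n = {h. length (snd h) = n}"

definition state_at :: "nat \<Rightarrow> ('e, 'a) history \<Rightarrow> 'e" where
  "state_at n h = (if n = 0 then fst h else snd (snd h ! (n - 1)))"

definition action_at :: "nat \<Rightarrow> ('e, 'a) history \<Rightarrow> 'a" where
  "action_at n h = fst (snd h ! n)"

definition history_upto :: "nat \<Rightarrow> ('e, 'a) history \<Rightarrow> ('e, 'a) history" where
  "history_upto n h = (fst h, take n (snd h))"

text \<open>
  Decision rules are total functions; only \<open>\<sigma> n h\<close> with \<open>n < N\<close> and \<open>h \<in> histories n\<close> ever
  enters \<open>path_law q \<nu> N \<sigma>\<close>, so the whole type represents \<open>\<Pi>\<^sub>N\<close>.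
\<close>

type_synonym ('e, 'a) policy = "nat \<Rightarrow> ('e, 'a) history \<Rightarrow> 'a pmf"

definition path_prob ::
  "('e \<Rightarrow> 'a \<Rightarrow> 'e pmf) \<Rightarrow> 'e pmf \<Rightarrow> nat \<Rightarrow> ('e, 'a) policy \<Rightarrow> ('e, 'a) history \<Rightarrow> real" where
  "path_prob q \<nu> N \<sigma> \<omega> =
     (if \<omega> \<in> histories N
      then pmf \<nu> (state_at 0 \<omega>) *
           (\<Prod>n<N. pmf (\<sigma> n (history_upto n \<omega>)) (action_at n \<omega>) *
                  pmf (q (state_at n \<omega>) (action_at n \<omega>)) (state_at (Suc n) \<omega>))
      else 0)"

text \<open>The measure \<open>\<P>\<^sub>\<nu>\<^sup>\<sigma>\<close>; \<open>pmf_path_law\<close> below shows that \<open>path_prob\<close> is indeed a mass function.\<close>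

definition path_law ::
  "('e \<Rightarrow> 'a \<Rightarrow> 'e pmf) \<Rightarrow> 'e pmf \<Rightarrow> nat \<Rightarrow> ('e, 'a) policy \<Rightarrow> ('e, 'a) history pmf" where
  "path_law q \<nu> N \<sigma> = embed_pmf (path_prob q \<nu> N \<sigma>)"

definition running_reward :: "('e \<Rightarrow> 'a \<Rightarrow> real) \<Rightarrow> nat \<Rightarrow> ('e, 'a) history \<Rightarrow> real" where
  "running_reward r n h = (\<Sum>k<n. r (state_at k h) (action_at k h))"

text \<open>
  \<open>accumulated_reward N r g n\<close> is \<open>R\<^sub>n\<close>. Thus \<open>running_reward r n\<close> is \<open>R\<^sub>n\<^sub>-\<^sub>1\<close> for \<open>1 \<le> n \<le> N\<close>, and it
  is the constant \<open>0\<close> for \<open>n = 0\<close>.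
\<close>

definition accumulated_reward ::
  "nat \<Rightarrow> ('e \<Rightarrow> 'a \<Rightarrow> real) \<Rightarrow> ('e \<Rightarrow> real) \<Rightarrow> nat \<Rightarrow> ('e, 'a) history \<Rightarrow> real" where
  "accumulated_reward N r g n \<omega> =
     (if n < N then running_reward r (Suc n) \<omega>
      else running_reward r N \<omega> + g (state_at N \<omega>))"

text \<open>
  The set \<open>S\<close>. The value \<open>0\<close>, the reward accumulated before the first step, is included, since the
  initial state \<open>\<nu> \<otimes> \<delta>\<^sub>0\<close> of the lifted problem has to be a distribution on \<open>E \<times> S\<close>.
\<close>

definition reward_values :: "nat \<Rightarrow> ('e \<Rightarrow> 'a \<Rightarrow> real) \<Rightarrow> ('e \<Rightarrow> real) \<Rightarrow> real set" where
  "reward_values N r g =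
     insert 0 {accumulated_reward N r g n \<omega> | n \<omega>. n \<le> N \<and> \<omega> \<in> histories N}"

text \<open>The joint distribution \<open>F\<^sub>n\<^sup>\<sigma>\<close> of \<open>(X\<^sub>n, R\<^sub>n\<^sub>-\<^sub>1)\<close>, for \<open>n \<le> N\<close>.\<close>

definition joint_law ::
  "nat \<Rightarrow> ('e \<Rightarrow> 'a \<Rightarrow> real) \<Rightarrow> ('e \<Rightarrow> 'a \<Rightarrow> 'e pmf) \<Rightarrow> 'e pmf \<Rightarrow> ('e, 'a) policy \<Rightarrow> nat \<Rightarrow>
   ('e \<times> real) pmf" where
  "joint_law N r q \<nu> \<sigma> n =
     map_pmf (\<lambda>\<omega>. (state_at n \<omega>, running_reward r n \<omega>)) (path_law q \<nu> N \<sigma>)"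


section \<open>The lifted problem\<close>

text \<open>\<open>P(E \<times> S)\<close>, as the probability mass functions on \<open>E \<times> \<real>\<close> concentrated on \<open>E \<times> S\<close>.\<close>

definition dists_on :: "real set \<Rightarrow> ('e \<times> real) pmf set" where
  "dists_on S = {F. set_pmf F \<subseteq> UNIV \<times> S}"

definition usc_dists :: "real set \<Rightarrow> (('e \<times> real) pmf \<Rightarrow> real) \<Rightarrow> bool" where
  "usc_dists S H \<longleftrightarrow>
     (\<forall>Fs F. (\<forall>k. Fs k \<in> dists_on S) \<and> F \<in> dists_on S \<and>
             (\<forall>z\<in>UNIV \<times> S. (\<lambda>k. pmf (Fs k) z) \<longlonglongrightarrow> pmf F z)
        \<longrightarrow> limsup (\<lambda>k. ereal (H (Fs k))) \<le> ereal (H F))"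

text \<open>As for policies, only the values of \<open>\<pi> \<in> \<Pi>\<^sup>M\<close> on \<open>E \<times> S\<close> matter for the transition function.\<close>

type_synonym ('e, 'a) lifted_action = "'e \<Rightarrow> real \<Rightarrow> 'a pmf"

text \<open>
  The mass function is given for every real \<open>s'\<close>, not only for \<open>s' \<in> S\<close>: for some \<open>F\<close> in \<open>P(E \<times> S)\<close>
  the transition moves mass out of \<open>E \<times> S\<close>. Lemma \<open>pmf_transition\<close> below shows that it is a mass
  function for every \<open>F\<close> in \<open>P(E \<times> S)\<close>.
\<close>

definition transition ::
  "real set \<Rightarrow> ('e::finite \<Rightarrow> 'a::finite \<Rightarrow> real) \<Rightarrow> ('e \<Rightarrow> 'a \<Rightarrow> 'e pmf) \<Rightarrow>
   ('e, 'a) lifted_action \<Rightarrow> ('e \<times> real) pmf \<Rightarrow> ('e \<times> real) pmf" where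
  "transition S r q \<pi> F = embed_pmf (\<lambda>(x', s').
     \<Sum>(x, s, a) \<in> {(x, s, a). s \<in> S \<and> r x a = s' - s}.
       pmf (q x a) x' * pmf (\<pi> x s) a * pmf F (x, s))"

definition initial_dist :: "'e pmf \<Rightarrow> ('e \<times> real) pmf" where
  "initial_dist \<nu> = pair_pmf \<nu> (return_pmf 0)"

text \<open>
  Because \<open>S\<close> is not closed under adding a one-stage reward, \<open>J\<^sub>n(F)\<close> makes sense only for those
  \<open>F \<in> P(E \<times> S)\<close> from which no choice of actions at the times \<open>n, \<dots>, N - 1\<close> leads out of \<open>P(E \<times> S)\<close>,
  where \<open>H\<close> is defined. These \<open>F\<close> form the set \<open>lifted_states S N r q n\<close>. For \<open>n = N\<close> it is all of
  \<open>P(E \<times> S)\<close>, and for \<open>n = 0\<close> it contains the initial state, see \<open>initial_dist_lifted_states\<close>.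
\<close>

function lifted_states ::
  "real set \<Rightarrow> nat \<Rightarrow> ('e::finite \<Rightarrow> 'a::finite \<Rightarrow> real) \<Rightarrow> ('e \<Rightarrow> 'a \<Rightarrow> 'e pmf) \<Rightarrow> nat \<Rightarrow>
   ('e \<times> real) pmf set" where
  "lifted_states S N r q n =
     (if n < N
      then {F \<in> dists_on S. \<forall>\<pi>. transition S r q \<pi> F \<in> lifted_states S N r q (Suc n)}
      else dists_on S)"
  by pat_completeness auto
termination by (relation "Wellfounded.measure (\<lambda>(S, N, r, q, n). N - n)") auto

declare lifted_states.simps [simp del]

text \<open>Values are taken in the extended reals, so that every supremum is a genuine one.\<close>

function J ::
  "real set \<Rightarrow> nat \<Rightarrow> ('e::finite \<Rightarrow> 'a::finite \<Rightarrow> real) \<Rightarrow> ('e \<Rightarrow> 'a \<Rightarrow> 'e pmf) \<Rightarrow>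
   (('e \<times> real) pmf \<Rightarrow> real) \<Rightarrow> nat \<Rightarrow> ('e \<times> real) pmf \<Rightarrow> ereal" where
  "J S N r q H n F =
     (if n < N then (SUP \<pi>. J S N r q H (Suc n) (transition S r q \<pi> F)) else ereal (H F))"
  by pat_completeness auto
termination by (relation "Wellfounded.measure (\<lambda>(S, N, r, q, H, n, F). N - n)") auto

declare J.simps [simp del]

definition maximizers ::
  "real set \<Rightarrow> nat \<Rightarrow> ('e::finite \<Rightarrow> 'a::finite \<Rightarrow> real) \<Rightarrow> ('e \<Rightarrow> 'a \<Rightarrow> 'e pmf) \<Rightarrow>
   (('e \<times> real) pmf \<Rightarrow> real) \<Rightarrow> (nat \<Rightarrow> ('e \<times> real) pmf \<Rightarrow> ('e, 'a) lifted_action) \<Rightarrow> bool" where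
  "maximizers S N r q H f \<longleftrightarrow>
     (\<forall>n<N. \<forall>F\<in>lifted_states S N r q n.
        is_arg_max (\<lambda>\<pi>. J S N r q H (Suc n) (transition S r q \<pi> F)) (\<lambda>_. True) (f n F))"

primrec optimal_state ::
  "real set \<Rightarrow> ('e::finite \<Rightarrow> 'a::finite \<Rightarrow> real) \<Rightarrow> ('e \<Rightarrow> 'a \<Rightarrow> 'e pmf) \<Rightarrow> 'e pmf \<Rightarrow>
   (nat \<Rightarrow> ('e \<times> real) pmf \<Rightarrow> ('e, 'a) lifted_action) \<Rightarrow> nat \<Rightarrow> ('e \<times> real) pmf" where
  "optimal_state S r q \<nu> f 0 = initial_dist \<nu>"
| "optimal_state S r q \<nu> f (Suc n) =
     transition S r q (f n (optimal_state S r q \<nu> f n)) (optimal_state S r q \<nu> f n)"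

definition optimal_action ::
  "real set \<Rightarrow> ('e::finite \<Rightarrow> 'a::finite \<Rightarrow> real) \<Rightarrow> ('e \<Rightarrow> 'a \<Rightarrow> 'e pmf) \<Rightarrow> 'e pmf \<Rightarrow>
   (nat \<Rightarrow> ('e \<times> real) pmf \<Rightarrow> ('e, 'a) lifted_action) \<Rightarrow> nat \<Rightarrow> ('e, 'a) lifted_action" where
  "optimal_action S r q \<nu> f n = f n (optimal_state S r q \<nu> f n)"

definition induced_policy ::
  "('e \<Rightarrow> 'a \<Rightarrow> real) \<Rightarrow> (nat \<Rightarrow> ('e, 'a) lifted_action) \<Rightarrow> ('e, 'a) policy" where
  "induced_policy r \<pi> n h = \<pi> n (state_at n h) (running_reward r n h)"


section \<open>Well-definedness\<close>

lemma embed_pmf_eqI: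
  assumes "\<And>x. f x = pmf p x"
  shows "embed_pmf f = p"
proof -
  have "f = pmf p" using assms by auto
  then show ?thesis
    using type_definition.Rep_inverse[OF td_pmf_embed_pmf, of p] by simp
qed

lemma finite_histories: "finite (histories n :: ('e::finite, 'a::finite) history set)"
proof -
  have "histories n = (UNIV :: 'e set) \<times> {l :: ('a \<times> 'e) list. length l = n}"
    by (auto simp: histories_def)
  moreover have "finite {l :: ('a \<times> 'e) list. length l = n}"
    using finite_lists_length_eq[of "UNIV :: ('a \<times> 'e) set" n] by simp
  ultimately show ?thesis by simp
qed

lemma finite_reward_values:
  fixes r :: "'e::finite \<Rightarrow> 'a::finite \<Rightarrow> real"
  shows "finite (reward_values N r g)"
proof -
  have "{accumulated_reward N r g n \<omega> | n \<omega>. n \<le> N \<and> \<omega> \<in> histories N} =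
        (\<lambda>(n, \<omega>). accumulated_reward N r g n \<omega>) ` ({..N} \<times> histories N)"
    by auto
  then show ?thesis by (simp add: reward_values_def finite_histories)
qed

primrec path_gen ::
  "('e \<Rightarrow> 'a \<Rightarrow> 'e pmf) \<Rightarrow> 'e pmf \<Rightarrow> ('e, 'a) policy \<Rightarrow> nat \<Rightarrow> ('e, 'a) history pmf" where
  "path_gen q \<nu> \<sigma> 0 = map_pmf (\<lambda>x. (x, [])) \<nu>"
| "path_gen q \<nu> \<sigma> (Suc n) =
     bind_pmf (path_gen q \<nu> \<sigma> n) (\<lambda>h. bind_pmf (\<sigma> n h) (\<lambda>a.
       map_pmf (\<lambda>x'. (fst h, snd h @ [(a, x')])) (q (state_at n h) a)))"

lemma set_path_gen: "set_pmf (path_gen q \<nu> \<sigma> n) \<subseteq> histories n"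
  by (induction n) (auto simp: histories_def)

lemma path_prob_eq_path_gen:
  fixes q :: "'e::finite \<Rightarrow> 'a::finite \<Rightarrow> 'e pmf"
  shows "path_prob q \<nu> N \<sigma> \<omega> = pmf (path_gen q \<nu> \<sigma> N) \<omega>"
proof (induction N arbitrary: \<omega>)
  case 0
  show ?case
  proof (cases "\<omega> \<in> histories 0")
    case True
    then have \<omega>: "\<omega> = (fst \<omega>, [])" by (cases \<omega>) (auto simp: histories_def)
    have "pmf (map_pmf (\<lambda>x. (x, [] :: ('a \<times> 'e) list)) \<nu>) (fst \<omega>, []) = pmf \<nu> (fst \<omega>)"
      by (rule pmf_map_inj') (auto simp: inj_def)
    with \<omega> True show ?thesis by (simp add: path_prob_def state_at_def)
  next
    case False
    then show ?thesis using set_path_gen[of q \<nu> \<sigma> 0]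
      by (auto simp: path_prob_def pmf_eq_0_set_pmf simp del: path_gen.simps)
  qed
next
  case (Suc n)
  show ?case
  proof (cases "\<omega> \<in> histories (Suc n)")
    case False
    then show ?thesis using set_path_gen[of q \<nu> \<sigma> "Suc n"]
      by (auto simp: path_prob_def pmf_eq_0_set_pmf simp del: path_gen.simps)
  next
    case True
    then obtain x0 l where "\<omega> = (x0, l)" "length l = Suc n"
      by (cases \<omega>) (auto simp: histories_def)
    then obtain m a x' where \<omega>: "\<omega> = (x0, m @ [(a, x')])" and m: "length m = n"
      by (cases l rule: rev_exhaust) auto
    let ?h = "(x0, m)"
    have step: "pmf (map_pmf (\<lambda>y. (fst h, snd h @ [(b, y)])) (q (state_at n h) b)) \<omega> =
        (if h = ?h \<and> b = a then pmf (q (state_at n ?h) a) x' else 0)" for h b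
    proof (cases "h = ?h \<and> b = a")
      case True
      have "pmf (map_pmf (\<lambda>y. (x0, m @ [(a, y)])) (q (state_at n ?h) a)) (x0, m @ [(a, x')]) =
          pmf (q (state_at n ?h) a) x'"
        by (rule pmf_map_inj') (auto simp: inj_def)
      with True \<omega> show ?thesis by simp
    next
      case False
      then have "\<omega> \<notin> set_pmf (map_pmf (\<lambda>y. (fst h, snd h @ [(b, y)])) (q (state_at n h) b))"
        using \<omega> by (cases h) auto
      then have "pmf (map_pmf (\<lambda>y. (fst h, snd h @ [(b, y)])) (q (state_at n h) b)) \<omega> = 0"
        by (simp add: pmf_eq_0_set_pmf)
      with False show ?thesis by auto
    qed
    have inner: "pmf (bind_pmf (\<sigma> n h) (\<lambda>b.
        map_pmf (\<lambda>y. (fst h, snd h @ [(b, y)])) (q (state_at n h) b))) \<omega> =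
        (if h = ?h then pmf (\<sigma> n ?h) a * pmf (q (state_at n ?h) a) x' else 0)" for h
      unfolding pmf_bind step
      by (subst integral_measure_pmf_real[where A = "{a}"]) (auto split: if_splits)
    have "pmf (path_gen q \<nu> \<sigma> (Suc n)) \<omega> =
        pmf (path_gen q \<nu> \<sigma> n) ?h * (pmf (\<sigma> n ?h) a * pmf (q (state_at n ?h) a) x')"
      unfolding path_gen.simps pmf_bind[of "path_gen q \<nu> \<sigma> n"] inner
      by (subst integral_measure_pmf_real[where A = "{?h}"]) (auto split: if_splits)
    moreover have "path_prob q \<nu> (Suc n) \<sigma> \<omega> =
        path_prob q \<nu> n \<sigma> ?h * (pmf (\<sigma> n ?h) a * pmf (q (state_at n ?h) a) x')"
    proof -
      have eq: "state_at k \<omega> = state_at k ?h" if "k \<le> n" for k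
        using that m by (auto simp: \<omega> state_at_def nth_append)
      have eq': "action_at k \<omega> = action_at k ?h" "history_upto k \<omega> = history_upto k ?h" if "k < n" for k
        using that m by (auto simp: \<omega> action_at_def history_upto_def nth_append)
      have "(\<Prod>k<n. pmf (\<sigma> k (history_upto k \<omega>)) (action_at k \<omega>) *
                  pmf (q (state_at k \<omega>) (action_at k \<omega>)) (state_at (Suc k) \<omega>)) =
            (\<Prod>k<n. pmf (\<sigma> k (history_upto k ?h)) (action_at k ?h) *
                  pmf (q (state_at k ?h) (action_at k ?h)) (state_at (Suc k) ?h))"
        by (intro prod.cong refl) (simp add: eq eq')
      moreover have "state_at (Suc n) \<omega> = x'" "action_at n \<omega> = a" "history_upto n \<omega> = ?h"
        using m by (auto simp: \<omega> state_at_def action_at_def history_upto_def nth_append)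
      ultimately show ?thesis
        using True m by (simp add: path_prob_def eq histories_def)
    qed
    ultimately show ?thesis using Suc by simp
  qed
qed

lemma path_law_eq_path_gen:
  fixes q :: "'e::finite \<Rightarrow> 'a::finite \<Rightarrow> 'e pmf"
  shows "path_law q \<nu> N \<sigma> = path_gen q \<nu> \<sigma> N"
  unfolding path_law_def by (rule embed_pmf_eqI) (rule path_prob_eq_path_gen)

lemma pmf_path_law:
  fixes q :: "'e::finite \<Rightarrow> 'a::finite \<Rightarrow> 'e pmf"
  shows "pmf (path_law q \<nu> N \<sigma>) \<omega> = path_prob q \<nu> N \<sigma> \<omega>"
  by (simp add: path_law_eq_path_gen path_prob_eq_path_gen)

definition transition_gen ::
  "('e \<Rightarrow> 'a \<Rightarrow> real) \<Rightarrow> ('e \<Rightarrow> 'a \<Rightarrow> 'e pmf) \<Rightarrow>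
   ('e, 'a) lifted_action \<Rightarrow> ('e \<times> real) pmf \<Rightarrow> ('e \<times> real) pmf" where
  "transition_gen r q \<pi> F = bind_pmf F (\<lambda>(x, s). bind_pmf (\<pi> x s) (\<lambda>a.
     map_pmf (\<lambda>x'. (x', s + r x a)) (q x a)))"

lemma pmf_transition_gen:
  fixes r :: "'e::finite \<Rightarrow> 'a::finite \<Rightarrow> real"
  assumes "finite S" "F \<in> dists_on S"
  shows "pmf (transition_gen r q \<pi> F) (x', s') =
     (\<Sum>(x, s, a) \<in> {(x, s, a). s \<in> S \<and> r x a = s' - s}.
       pmf (q x a) x' * pmf (\<pi> x s) a * pmf F (x, s))"
proof -
  have step: "pmf (map_pmf (\<lambda>y. (y, s + r x a)) (q x a)) (x', s') =
      (if r x a = s' - s then pmf (q x a) x' else 0)" for x s a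
  proof (cases "r x a = s' - s")
    case True
    have "pmf (map_pmf (\<lambda>y. (y, s + r x a)) (q x a)) (x', s + r x a) = pmf (q x a) x'"
      by (rule pmf_map_inj') (auto simp: inj_def)
    with True show ?thesis by simp
  next
    case False
    then show ?thesis by (auto simp: pmf_eq_0_set_pmf)
  qed
  have inner: "pmf (bind_pmf (\<pi> x s) (\<lambda>a. map_pmf (\<lambda>y. (y, s + r x a)) (q x a))) (x', s') =
      (\<Sum>a\<in>UNIV. if r x a = s' - s then pmf (q x a) x' * pmf (\<pi> x s) a else 0)" for x s
    unfolding pmf_bind step
    by (subst integral_measure_pmf_real[where A = UNIV]) (auto intro!: sum.cong)
  have "pmf (transition_gen r q \<pi> F) (x', s') = (\<Sum>(x, s)\<in>UNIV \<times> S.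
      (\<Sum>a\<in>UNIV. if r x a = s' - s then pmf (q x a) x' * pmf (\<pi> x s) a else 0) * pmf F (x, s))"
    unfolding transition_gen_def pmf_bind[of F]
    by (subst integral_measure_pmf_real[where A = "UNIV \<times> S"])
       (use assms in \<open>auto simp: dists_on_def inner intro!: sum.cong\<close>)
  also have "\<dots> = (\<Sum>x\<in>UNIV. \<Sum>s\<in>S. \<Sum>a\<in>UNIV.
      if r x a = s' - s then pmf (q x a) x' * pmf (\<pi> x s) a * pmf F (x, s) else 0)"
    by (simp add: sum.cartesian_product[symmetric] sum_distrib_right if_distrib[of "\<lambda>t. t * _"] cong: if_cong)
  also have "\<dots> = (\<Sum>(x, s, a)\<in>UNIV \<times> S \<times> UNIV.
      if r x a = s' - s then pmf (q x a) x' * pmf (\<pi> x s) a * pmf F (x, s) else 0)"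
    by (simp add: sum.cartesian_product)
  also have "\<dots> = (\<Sum>(x, s, a) \<in> {(x, s, a). s \<in> S \<and> r x a = s' - s}.
       pmf (q x a) x' * pmf (\<pi> x s) a * pmf F (x, s))"
    by (rule sum.mono_neutral_cong_right) (use assms in \<open>auto split: if_splits\<close>)
  finally show ?thesis .
qed

lemma transition_eq_transition_gen:
  assumes "finite S" "F \<in> dists_on S"
  shows "transition S r q \<pi> F = transition_gen r q \<pi> F"
  unfolding transition_def
  by (rule embed_pmf_eqI) (auto simp: pmf_transition_gen[OF assms])

lemma pmf_transition:
  assumes "finite S" "F \<in> dists_on S"
  shows "pmf (transition S r q \<pi> F) (x', s') =
     (\<Sum>(x, s, a) \<in> {(x, s, a). s \<in> S \<and> r x a = s' - s}.
       pmf (q x a) x' * pmf (\<pi> x s) a * pmf F (x, s))"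
  using assms by (simp add: transition_eq_transition_gen pmf_transition_gen)

lemma running_reward_in_reward_values:
  fixes h :: "('e::finite, 'a::finite) history"
  assumes "h \<in> histories n" "n \<le> N"
  shows "running_reward r n h \<in> reward_values N r g"
proof (cases n)
  case 0
  then show ?thesis by (simp add: running_reward_def reward_values_def)
next
  case (Suc m)
  define \<omega> where "\<omega> = (fst h, snd h @ replicate (N - n) undefined)"
  have "\<omega> \<in> histories N" using assms by (simp add: \<omega>_def histories_def)
  moreover have "running_reward r n \<omega> = running_reward r n h"
    unfolding running_reward_def using assms
    by (intro sum.cong) (auto simp: \<omega>_def state_at_def action_at_def histories_def nth_append)
  moreover have "accumulated_reward N r g m \<omega> = running_reward r n \<omega>"
    using Suc assms by (simp add: accumulated_reward_def)
  ultimately have "\<exists>k \<omega>. running_reward r n h = accumulated_reward N r g k \<omega> \<and> k \<le> N \<and> \<omega> \<in> histories N"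
    using Suc assms by (intro exI[of _ m] exI[of _ \<omega>]) auto
  then show ?thesis by (auto simp: reward_values_def)
qed

lemma lifted_statesI:
  fixes r :: "'e::finite \<Rightarrow> 'a::finite \<Rightarrow> real"
  assumes "n \<le> N"
    and "set_pmf F \<subseteq> (\<lambda>h. (state_at n h, running_reward r n h)) ` histories n"
  shows "F \<in> lifted_states (reward_values N r g) N r q n"
  using assms
proof (induction n arbitrary: F rule: inc_induct)
  case base
  then have "F \<in> dists_on (reward_values N r g)"
    using running_reward_in_reward_values[of _ N N r g] by (auto simp: dists_on_def)
  then show ?case by (simp add: lifted_states.simps)
next
  case (step n)
  have F: "F \<in> dists_on (reward_values N r g)"
    using step.hyps step.prems running_reward_in_reward_values[of _ n N r g]
    by (auto simp: dists_on_def)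
  have "transition (reward_values N r g) r q \<pi> F \<in> lifted_states (reward_values N r g) N r q (Suc n)" for \<pi>
  proof (rule step.IH)
    show "set_pmf (transition (reward_values N r g) r q \<pi> F) \<subseteq>
        (\<lambda>h. (state_at (Suc n) h, running_reward r (Suc n) h)) ` histories (Suc n)"
    proof
      fix z assume "z \<in> set_pmf (transition (reward_values N r g) r q \<pi> F)"
      then obtain x s a x' where *: "(x, s) \<in> set_pmf F" "z = (x', s + r x a)"
        by (auto simp: transition_eq_transition_gen[OF finite_reward_values F] transition_gen_def)
      then obtain h where h: "h \<in> histories n" "x = state_at n h" "s = running_reward r n h"
        using step.prems by auto
      let ?h = "(fst h, snd h @ [(a, x')])"
      have eq: "state_at k ?h = state_at k h" if "k \<le> n" for k
        using that h(1) by (auto simp: histories_def state_at_def nth_append)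
      have eq': "action_at k ?h = action_at k h" if "k < n" for k
        using that h(1) by (auto simp: histories_def action_at_def nth_append)
      have "running_reward r n ?h = running_reward r n h"
        unfolding running_reward_def by (intro sum.cong) (auto simp: eq eq')
      moreover have "action_at n ?h = a" "state_at (Suc n) ?h = x'" "?h \<in> histories (Suc n)"
        using h(1) by (auto simp: histories_def action_at_def state_at_def nth_append)
      ultimately have "z = (state_at (Suc n) ?h, running_reward r (Suc n) ?h)"
        using * h eq[of n] by (simp add: running_reward_def)
      with \<open>?h \<in> histories (Suc n)\<close>
      show "z \<in> (\<lambda>h. (state_at (Suc n) h, running_reward r (Suc n) h)) ` histories (Suc n)"
        by blast
    qed
  qed
  with F show ?case using step.hyps by (subst lifted_states.simps) auto
qed

lemma initial_dist_lifted_states: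
  fixes r :: "'e::finite \<Rightarrow> 'a::finite \<Rightarrow> real"
  shows "initial_dist \<nu> \<in> lifted_states (reward_values N r g) N r q 0"
proof (rule lifted_statesI)
  show "set_pmf (initial_dist \<nu>) \<subseteq> (\<lambda>h. (state_at 0 h, running_reward r 0 h)) ` histories 0"
  proof
    fix z assume "z \<in> set_pmf (initial_dist \<nu>)"
    then obtain x where "z = (x, 0)" by (auto simp: initial_dist_def)
    then show "z \<in> (\<lambda>h. (state_at 0 h, running_reward r 0 h)) ` histories 0"
      by (intro image_eqI[of _ _ "(x, [])"]) (auto simp: state_at_def running_reward_def histories_def)
  qed
qed simp

end

theory Submission
  imports Defs
begin

text \<open>
  The objective depends on a policy only through the law of \<open>(X\<^sub>N, R\<^sub>N\<^sub>-\<^sub>1)\<close>, and this law evolves like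
  the state of the lifted problem. Given a history-dependent policy, average its decision rule at
  time \<open>n\<close> over all histories that share the same current state \<open>x\<close> and accumulated reward \<open>s\<close>. The
  averaged rule is a lifted action, and it moves the law of \<open>(X\<^sub>n, R\<^sub>n\<^sub>-\<^sub>1)\<close> to the law of
  \<open>(X\<^sub>n\<^sub>+\<^sub>1, R\<^sub>n)\<close>, because reward and transition at time \<open>n\<close> see the history only through
  \<open>(x, s)\<close> and the action (\<open>joint_law_Suc_averaged\<close>). So every policy produces a trajectory of the
  lifted problem. Conversely, every sequence of lifted actions is a policy that looks only at
  \<open>(x, s)\<close>, and its joint laws are moved by these actions themselves (\<open>joint_law_induced_policy\<close>).

  Since \<open>J\<close> cannot increase along a trajectory, \<open>H(F\<^sub>N\<^sup>\<sigma>) \<le> J\<^sub>0(F\<^sub>0)\<close> for every policy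
  (\<open>H_joint_law_le_J\<close>). Along the trajectory chosen by maximizers it is constant, so the induced
  policy attains this bound (\<open>J_eq_H_induced_policy\<close>). Both the formula for the value and the
  optimality of the induced policy follow, once maximizers are known to exist.

  Existence is a compactness argument. Only the values of a lifted action on the finite set \<open>E \<times> S\<close>
  matter, so every sequence of lifted actions has a subsequence that converges there
  (\<open>pmf_sequence_compact\<close>), and the transition is jointly continuous in distribution and action.
  Hence, if \<open>J\<^sub>n\<^sub>+\<^sub>1\<close> is upper semicontinuous, a maximizing sequence of actions has a maximizing limit.
  Applied to a maximizing action for each member of a convergent sequence of distributions, the
  same limit argument shows that \<open>J\<^sub>n\<close> is again upper semicontinuous (\<open>J_usc\<close>), so the induction
  proceeds backwards from \<open>H\<close>.
\<close>

section \<open>Compactness of the lifted actions and continuity of the transition\<close>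

text \<open>
  Kernels from a finite set to a finite set are finitely many numbers in \<open>[0, 1]\<close>, so
  Bolzano-Weierstrass applies. No mass is lost in the limit, because the total mass is a finite sum.
\<close>

lemma pmf_sequence_compact:
  fixes \<kappa> :: "nat \<Rightarrow> 'i \<Rightarrow> 'a::finite pmf"
  assumes "finite I"
  obtains \<phi> \<kappa>' where "strict_mono \<phi>"
    and "\<And>i a. i \<in> I \<Longrightarrow> (\<lambda>k. pmf (\<kappa> (\<phi> k) i) a) \<longlonglongrightarrow> pmf (\<kappa>' i) a"
proof -
  let ?f = "\<lambda>k z. pmf (\<kappa> k (fst z)) (snd z)"
  have "\<forall>d\<subseteq>I \<times> (UNIV :: 'a set). \<exists>l::'i \<times> 'a \<Rightarrow> real. \<exists>\<phi>::nat\<Rightarrow>nat. strict_mono \<phi> \<and>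
      (\<forall>e>0. eventually (\<lambda>k. \<forall>z\<in>d. dist (?f (\<phi> k) z) (l z) < e) sequentially)"
    using assms
    by (intro compact_lemma_general[where proj = "\<lambda>h z. h z" and unproj = "\<lambda>h. h"])
       (auto intro!: boundedI[where B = 1] pmf_le_1)
  from spec[OF this, THEN mp, OF order_refl]
  obtain l :: "'i \<times> 'a \<Rightarrow> real" and \<phi> :: "nat \<Rightarrow> nat" where \<phi>: "strict_mono \<phi>"
    and l: "\<And>e. e > 0 \<Longrightarrow>
      eventually (\<lambda>k. \<forall>z\<in>I \<times> UNIV. dist (?f (\<phi> k) z) (l z) < e) sequentially"
    by blast
  have lim: "(\<lambda>k. pmf (\<kappa> (\<phi> k) i) a) \<longlonglongrightarrow> l (i, a)" if "i \<in> I" for i a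
    using that by (intro tendstoI eventually_mono[OF l]) auto
  have limit_pmf: "pmf (embed_pmf (\<lambda>b. l (i, b))) a = l (i, a)" if i: "i \<in> I" for i a
  proof (rule pmf_embed_pmf)
    show nonneg: "0 \<le> l (i, b)" for b
      by (rule LIMSEQ_le_const[OF lim[OF i]]) auto
    have "(\<lambda>k. \<Sum>b\<in>UNIV. pmf (\<kappa> (\<phi> k) i) b) \<longlonglongrightarrow> (\<Sum>b\<in>UNIV. l (i, b))"
      by (intro tendsto_sum lim i)
    moreover have "(\<Sum>b\<in>UNIV. pmf (\<kappa> (\<phi> k) i) b) = 1" for k
      by (rule sum_pmf_eq_1) auto
    ultimately have "(\<Sum>b\<in>UNIV. l (i, b)) = 1"
      by (simp add: LIMSEQ_const_iff)
    then show "(\<integral>\<^sup>+b. ennreal (l (i, b)) \<partial>count_space UNIV) = 1"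
      by (simp add: nn_integral_count_space_finite sum_ennreal nonneg)
  qed
  show thesis
    by (rule that[OF \<phi>, of "\<lambda>i. embed_pmf (\<lambda>b. l (i, b))"]) (simp add: limit_pmf lim)
qed

text \<open>
  The mass at each point is a finite sum of products that are continuous in \<open>\<pi>\<close> and \<open>F\<close>. The action
  has to converge only at rewards in \<open>S\<close>, since \<open>F\<close> puts no mass elsewhere; this makes the
  compactness of kernels on the finite set \<open>E \<times> S\<close> sufficient.
\<close>

lemma transition_continuous:
  fixes r :: "'e::finite \<Rightarrow> 'a::finite \<Rightarrow> real"
  assumes S: "finite S"
    and dist: "\<And>k. Fs k \<in> dists_on S" "F \<in> dists_on S"
    and F: "\<And>z. (\<lambda>k. pmf (Fs k) z) \<longlonglongrightarrow> pmf F z"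
    and \<pi>: "\<And>x s a. s \<in> S \<Longrightarrow> (\<lambda>k. pmf (\<pi>s k x s) a) \<longlonglongrightarrow> pmf (\<pi> x s) a"
  shows "(\<lambda>k. pmf (transition S r q (\<pi>s k) (Fs k)) z) \<longlonglongrightarrow> pmf (transition S r q \<pi> F) z"
proof (cases z)
  case (Pair x' s')
  show ?thesis
    unfolding Pair pmf_transition[OF S dist(1)] pmf_transition[OF S dist(2)] case_prod_beta
    by (intro tendsto_sum tendsto_mult tendsto_const F \<pi>) auto
qed

section \<open>Upper semicontinuity and existence of maximizers\<close>

definition usc_on :: "'z pmf set \<Rightarrow> ('z pmf \<Rightarrow> ereal) \<Rightarrow> bool" where
  "usc_on C V \<longleftrightarrow>
     (\<forall>Fs F. (\<forall>k. Fs k \<in> C) \<longrightarrow> F \<in> C \<longrightarrow> (\<forall>z. (\<lambda>k. pmf (Fs k) z) \<longlonglongrightarrow> pmf F z)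
        \<longrightarrow> limsup (\<lambda>k. V (Fs k)) \<le> V F)"

lemma usc_onD:
  assumes "usc_on C V" "\<And>k. Fs k \<in> C" "F \<in> C" "\<And>z. (\<lambda>k. pmf (Fs k) z) \<longlonglongrightarrow> pmf F z"
  shows "limsup (\<lambda>k. V (Fs k)) \<le> V F"
  using assms by (auto simp: usc_on_def)

text \<open>
  The common core of existence and semicontinuity. For a constant sequence \<open>Fs\<close> and a maximizing
  sequence \<open>\<pi>s\<close> it yields a maximizer; for varying \<open>Fs\<close> and actions \<open>\<pi>s k\<close> that are optimal at
  \<open>Fs k\<close> it yields upper semicontinuity of \<open>F \<mapsto> SUP \<pi>. V (T\<^sup>\<pi>(F))\<close>. The action \<open>\<pi>\<close> is a limit of
  \<open>\<pi>s\<close> along a subsequence on which the limit superior is attained.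
\<close>

lemma limsup_transition_bounded_by_limit_action:
  fixes r :: "'e::finite \<Rightarrow> 'a::finite \<Rightarrow> real"
  assumes S: "finite S" and usc: "usc_on C V"
    and dist: "\<And>k. Fs k \<in> dists_on S" "F \<in> dists_on S"
    and C: "\<And>k \<pi>. transition S r q \<pi> (Fs k) \<in> C" "\<And>\<pi>. transition S r q \<pi> F \<in> C"
    and F: "\<And>z. (\<lambda>k. pmf (Fs k) z) \<longlonglongrightarrow> pmf F z"
  shows "\<exists>\<pi>. limsup (\<lambda>k. V (transition S r q (\<pi>s k) (Fs k))) \<le> V (transition S r q \<pi> F)"
proof -
  let ?v = "\<lambda>k. V (transition S r q (\<pi>s k) (Fs k))"
  obtain \<phi> :: "nat \<Rightarrow> nat" where \<phi>: "strict_mono \<phi>" "(?v \<circ> \<phi>) \<longlonglongrightarrow> limsup ?v"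
    using limsup_subseq_lim[of ?v] by blast
  obtain \<psi> \<kappa> where \<psi>: "strict_mono \<psi>"
    and \<kappa>: "\<And>i a. i \<in> UNIV \<times> S \<Longrightarrow>
      (\<lambda>k. pmf (\<pi>s (\<phi> (\<psi> k)) (fst i) (snd i)) a) \<longlonglongrightarrow> pmf (\<kappa> i) a"
    using pmf_sequence_compact[of "UNIV \<times> S" "\<lambda>k i. \<pi>s (\<phi> k) (fst i) (snd i)"] S by auto
  \<comment> \<open>Outside \<open>E \<times> S\<close> the values of \<open>\<kappa>\<close> are unspecified, which is harmless for the transition.\<close>
  define \<pi> where "\<pi> x s = \<kappa> (x, s)" for x s
  have mono: "strict_mono (\<phi> \<circ> \<psi>)"
    using \<phi>(1) \<psi> by (rule strict_mono_o)
  have "(\<lambda>k. pmf (transition S r q (\<pi>s ((\<phi> \<circ> \<psi>) k)) (Fs ((\<phi> \<circ> \<psi>) k))) z)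
      \<longlonglongrightarrow> pmf (transition S r q \<pi> F) z" for z
  proof (rule transition_continuous[OF S dist(1) dist(2)])
    show "(\<lambda>k. pmf (Fs ((\<phi> \<circ> \<psi>) k)) y) \<longlonglongrightarrow> pmf F y" for y
      using LIMSEQ_subseq_LIMSEQ[OF F mono] by (simp add: o_def)
    show "(\<lambda>k. pmf (\<pi>s ((\<phi> \<circ> \<psi>) k) x s) a) \<longlonglongrightarrow> pmf (\<pi> x s) a" if "s \<in> S" for x s a
      using \<kappa>[of "(x, s)" a] that by (simp add: \<pi>_def)
  qed
  with usc C have "limsup (\<lambda>k. ?v ((\<phi> \<circ> \<psi>) k)) \<le> V (transition S r q \<pi> F)"
    by (intro usc_onD[of C V "\<lambda>k. transition S r q (\<pi>s ((\<phi> \<circ> \<psi>) k)) (Fs ((\<phi> \<circ> \<psi>) k))"]) auto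
  moreover have "limsup (\<lambda>k. ?v ((\<phi> \<circ> \<psi>) k)) = limsup ?v"
    using LIMSEQ_subseq_LIMSEQ[OF \<phi>(2) \<psi>] by (intro lim_imp_Limsup) (auto simp: o_def)
  ultimately show ?thesis by auto
qed

lemma maximizing_action_exists:
  fixes r :: "'e::finite \<Rightarrow> 'a::finite \<Rightarrow> real"
  assumes S: "finite S" and usc: "usc_on C V"
    and dist: "F \<in> dists_on S" and C: "\<And>\<pi>. transition S r q \<pi> F \<in> C"
  shows "\<exists>\<pi>. V (transition S r q \<pi> F) = (SUP \<pi>. V (transition S r q \<pi> F))"
proof -
  let ?g = "\<lambda>\<pi>. V (transition S r q \<pi> F)"
  obtain u :: "nat \<Rightarrow> ereal" where u: "incseq u" "range u \<subseteq> range ?g" "(SUP \<pi>. ?g \<pi>) = (SUP i. u i)"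
    using Sup_countable_SUP[of "range ?g"] by auto
  have "\<forall>k. \<exists>\<pi>. u k = ?g \<pi>" using u(2) by auto
  then obtain \<pi>s where \<pi>s: "\<And>k. u k = ?g (\<pi>s k)" by metis
  obtain \<pi> where "limsup (\<lambda>k. ?g (\<pi>s k)) \<le> ?g \<pi>"
    using limsup_transition_bounded_by_limit_action[OF S usc, of "\<lambda>_. F" F r q \<pi>s] dist C by auto
  moreover have "limsup (\<lambda>k. ?g (\<pi>s k)) = (SUP \<pi>. ?g \<pi>)"
    using LIMSEQ_SUP[OF u(1)] unfolding u(3) \<pi>s[symmetric] by (intro lim_imp_Limsup) auto
  ultimately have "?g \<pi> = (SUP \<pi>. ?g \<pi>)"
    by (intro antisym SUP_upper) auto
  then show ?thesis by blast
qed

lemma lifted_states_dists_on: "F \<in> lifted_states S N r q n \<Longrightarrow> F \<in> dists_on S"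
  by (subst (asm) lifted_states.simps) (auto split: if_splits)

lemma transition_lifted_states:
  "n < N \<Longrightarrow> F \<in> lifted_states S N r q n \<Longrightarrow> transition S r q \<pi> F \<in> lifted_states S N r q (Suc n)"
  by (subst (asm) lifted_states.simps) auto

lemma J_attained_if_usc:
  fixes r :: "'e::finite \<Rightarrow> 'a::finite \<Rightarrow> real"
  assumes "finite S" "n < N" "F \<in> lifted_states S N r q n"
    and "usc_on (lifted_states S N r q (Suc n)) (J S N r q H (Suc n))"
  shows "\<exists>\<pi>. J S N r q H n F = J S N r q H (Suc n) (transition S r q \<pi> F)"
proof -
  obtain \<pi> where "J S N r q H (Suc n) (transition S r q \<pi> F) =
      (SUP \<pi>. J S N r q H (Suc n) (transition S r q \<pi> F))"
    using maximizing_action_exists[OF assms(1,4) lifted_states_dists_on[OF assms(3)]]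
      transition_lifted_states[OF assms(2,3)] by blast
  moreover have "J S N r q H n F = (SUP \<pi>. J S N r q H (Suc n) (transition S r q \<pi> F))"
    using assms(2) by (subst J.simps) simp
  ultimately show ?thesis by metis
qed

lemma J_upper:
  "n < N \<Longrightarrow> J S N r q H (Suc n) (transition S r q \<pi> F) \<le> J S N r q H n F"
  by (subst (2) J.simps) (auto intro: SUP_upper)

text \<open>
  Backward induction. In the step, replace \<open>J\<^sub>n(F\<^sub>(\<^sub>k\<^sub>))\<close> by the value \<open>J\<^sub>n\<^sub>+\<^sub>1\<close> takes after an optimal action
  \<open>\<pi>\<^sub>k\<close>. A limit of the \<open>\<pi>\<^sub>k\<close> is one of the actions over which \<open>J\<^sub>n(F)\<close> is the supremum.
\<close>

lemma J_usc:
  fixes r :: "'e::finite \<Rightarrow> 'a::finite \<Rightarrow> real"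
  assumes S: "finite S" and H: "usc_dists S H" and n: "n \<le> N"
  shows "usc_on (lifted_states S N r q n) (J S N r q H n)"
  using n
proof (induction n rule: inc_induct)
  case base
  have "J S N r q H N F = ereal (H F)" for F by (subst J.simps) simp
  moreover have "lifted_states S N r q N = dists_on S" by (subst lifted_states.simps) simp
  ultimately show ?case using H by (auto simp: usc_on_def usc_dists_def)
next
  case (step n)
  let ?J = "J S N r q H"
  show ?case
    unfolding usc_on_def
  proof (intro allI impI)
    fix Fs F
    assume Fs: "\<forall>k. Fs k \<in> lifted_states S N r q n" and F: "F \<in> lifted_states S N r q n"
      and lim: "\<forall>z. (\<lambda>k. pmf (Fs k) z) \<longlonglongrightarrow> pmf F z"
    have "\<forall>k. \<exists>\<pi>. ?J n (Fs k) = ?J (Suc n) (transition S r q \<pi> (Fs k))"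
      using J_attained_if_usc[OF S step.hyps(2) _ step.IH] Fs by blast
    then obtain \<pi>s where \<pi>s: "\<And>k. ?J n (Fs k) = ?J (Suc n) (transition S r q (\<pi>s k) (Fs k))"
      by metis
    obtain \<pi> where "limsup (\<lambda>k. ?J (Suc n) (transition S r q (\<pi>s k) (Fs k)))
        \<le> ?J (Suc n) (transition S r q \<pi> F)"
      using limsup_transition_bounded_by_limit_action[OF S step.IH, of Fs F r q \<pi>s] Fs F lim step.hyps
        lifted_states_dists_on transition_lifted_states by blast
    also have "\<dots> \<le> ?J n F" using step.hyps by (intro J_upper) simp
    finally show "limsup (\<lambda>k. ?J n (Fs k)) \<le> ?J n F" by (simp add: \<pi>s)
  qed
qed

lemma maximizers_exist:
  fixes r :: "'e::finite \<Rightarrow> 'a::finite \<Rightarrow> real"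
  assumes S: "finite S" and H: "usc_dists S H"
  shows "\<exists>f. maximizers S N r q H f"
proof -
  have "\<exists>\<pi>. n < N \<and> F \<in> lifted_states S N r q n \<longrightarrow>
      J S N r q H n F = J S N r q H (Suc n) (transition S r q \<pi> F)" for n F
    using J_attained_if_usc[OF S] J_usc[OF S H] by (metis Suc_leI)
  then obtain f where f: "\<And>n F. n < N \<Longrightarrow> F \<in> lifted_states S N r q n \<Longrightarrow>
      J S N r q H n F = J S N r q H (Suc n) (transition S r q (f n F) F)"
    by metis
  then have "maximizers S N r q H f"
    by (auto simp: maximizers_def is_arg_max_linorder f[symmetric] intro: J_upper)
  then show ?thesis by blast
qed

lemma J_maximizers:
  assumes "maximizers S N r q H f" "n < N" "F \<in> lifted_states S N r q n"
  shows "J S N r q H n F = J S N r q H (Suc n) (transition S r q (f n F) F)"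
  using assms
  by (subst J.simps)
     (auto simp: maximizers_def is_arg_max_linorder intro!: antisym SUP_least SUP_upper)

section \<open>Joint laws under policies as trajectories of the lifted problem\<close>

text \<open>
  The law of total probability. With \<open>f\<close> the pair of current state and accumulated reward, it allows
  the part of a history that \<open>f\<close> forgets to be averaged out.
\<close>

lemma bind_cond_pmf_fibers:
  "bind_pmf (map_pmf f p) (\<lambda>z. cond_pmf p {h. f h = z}) = p"
proof (rule bind_cond_pmf_cancel)
  fix z h assume "f h = z"
  then have "f -` {z'. f h = z'} = {h'. f h' = z}" by auto
  then show "measure_pmf.prob p {h. f h = z} = measure_pmf.prob (map_pmf f p) {z'. f h = z'}"
    by simp
qed auto

text \<open>
  The horizon of the path law is \<open>n\<close> here and below, instead of \<open>N\<close>: the law of \<open>(X\<^sub>n, R\<^sub>n\<^sub>-\<^sub>1)\<close> involves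
  only the first \<open>n\<close> steps, and with growing horizon it can be computed by recursion on \<open>n\<close>.
\<close>

lemma joint_law_in_lifted_states:
  fixes r :: "'e::finite \<Rightarrow> 'a::finite \<Rightarrow> real"
  assumes "n \<le> N"
  shows "joint_law n r q \<nu> \<sigma> n \<in> lifted_states (reward_values N r g) N r q n"
  using assms set_path_gen[of q \<nu> \<sigma> n]
  by (intro lifted_statesI) (auto simp: joint_law_def path_law_eq_path_gen)

lemma joint_law_0:
  fixes r :: "'e::finite \<Rightarrow> 'a::finite \<Rightarrow> real"
  shows "joint_law 0 r q \<nu> \<sigma> 0 = initial_dist \<nu>"
  by (simp add: joint_law_def path_law_eq_path_gen initial_dist_def pair_pmf_def map_pmf_def
    bind_assoc_pmf bind_return_pmf state_at_def running_reward_def)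

lemma joint_law_Suc:
  fixes r :: "'e::finite \<Rightarrow> 'a::finite \<Rightarrow> real"
  shows "joint_law (Suc n) r q \<nu> \<sigma> (Suc n) =
    bind_pmf (path_gen q \<nu> \<sigma> n) (\<lambda>h. bind_pmf (\<sigma> n h) (\<lambda>a.
      map_pmf (\<lambda>x'. (x', running_reward r n h + r (state_at n h) a)) (q (state_at n h) a)))"
proof -
  have eq: "state_at (Suc n) (fst h, snd h @ [(a, x')]) = x'"
    "running_reward r (Suc n) (fst h, snd h @ [(a, x')]) = running_reward r n h + r (state_at n h) a"
    if "h \<in> set_pmf (path_gen q \<nu> \<sigma> n)" for h a x'
  proof -
    have len: "length (snd h) = n" using that set_path_gen[of q \<nu> \<sigma> n] by (auto simp: histories_def)
    have st: "state_at k (fst h, snd h @ [(a, x')]) = state_at k h" if "k \<le> n" for k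
      using that len by (auto simp: state_at_def nth_append)
    show "state_at (Suc n) (fst h, snd h @ [(a, x')]) = x'"
      using len by (simp add: state_at_def nth_append)
    show "running_reward r (Suc n) (fst h, snd h @ [(a, x')]) = running_reward r n h + r (state_at n h) a"
      using len by (auto simp: running_reward_def st action_at_def nth_append)
  qed
  show ?thesis
    unfolding joint_law_def path_law_eq_path_gen path_gen.simps map_bind_pmf map_pmf_comp
    by (intro bind_pmf_cong refl map_pmf_cong) (simp add: eq)
qed

text \<open>
  The conditional law of the action \<open>A\<^sub>n\<close> given \<open>(X\<^sub>n, R\<^sub>n\<^sub>-\<^sub>1) = (x, s)\<close>. If this event has probability zero,
  \<open>cond_pmf\<close> is an unspecified distribution; such \<open>(x, s)\<close> carry no mass in the joint law.
\<close>

definition averaged_rule ::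
  "('e \<Rightarrow> 'a \<Rightarrow> real) \<Rightarrow> ('e \<Rightarrow> 'a \<Rightarrow> 'e pmf) \<Rightarrow> 'e pmf \<Rightarrow> ('e, 'a) policy \<Rightarrow> nat \<Rightarrow>
   ('e, 'a) lifted_action" where
  "averaged_rule r q \<nu> \<sigma> n x s =
     bind_pmf (cond_pmf (path_gen q \<nu> \<sigma> n) {h. (state_at n h, running_reward r n h) = (x, s)}) (\<sigma> n)"

text \<open>
  Conditioning on \<open>(X\<^sub>n, R\<^sub>n\<^sub>-\<^sub>1)\<close> first, the rest of the step after the choice of the action depends only
  on this pair and the action, so the history enters only through the conditional law of the action.
\<close>

lemma joint_law_Suc_averaged:
  fixes r :: "'e::finite \<Rightarrow> 'a::finite \<Rightarrow> real"
  shows "joint_law (Suc n) r q \<nu> \<sigma> (Suc n) =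
    transition_gen r q (averaged_rule r q \<nu> \<sigma> n) (joint_law n r q \<nu> \<sigma> n)"
proof -
  let ?p = "path_gen q \<nu> \<sigma> n"
  let ?f = "\<lambda>h. (state_at n h, running_reward r n h)"
  let ?K = "\<lambda>(x, s) a. map_pmf (\<lambda>x'. (x', s + r x a)) (q x a)"
  have "joint_law (Suc n) r q \<nu> \<sigma> (Suc n) = bind_pmf ?p (\<lambda>h. bind_pmf (\<sigma> n h) (?K (?f h)))"
    by (simp add: joint_law_Suc)
  also have "\<dots> = bind_pmf (map_pmf ?f ?p) (\<lambda>z. bind_pmf (cond_pmf ?p {h. ?f h = z})
      (\<lambda>h. bind_pmf (\<sigma> n h) (?K (?f h))))"
    by (subst (1) bind_cond_pmf_fibers[of ?f ?p, symmetric]) (simp only: bind_assoc_pmf)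
  also have "\<dots> = bind_pmf (map_pmf ?f ?p) (\<lambda>z. bind_pmf (cond_pmf ?p {h. ?f h = z})
      (\<lambda>h. bind_pmf (\<sigma> n h) (?K z)))"
    \<comment> \<open>The conditional law lives on the fiber \<open>?f h = z\<close>.\<close>
  proof (intro bind_pmf_cong refl)
    fix z h a assume z: "z \<in> set_pmf (map_pmf ?f ?p)" and h: "h \<in> set_pmf (cond_pmf ?p {h. ?f h = z})"
    have "set_pmf ?p \<inter> {h. ?f h = z} \<noteq> {}" using z by auto
    then have "?f h = z" using h by simp
    then show "?K (?f h) a = ?K z a" by simp
  qed
  also have "\<dots> = transition_gen r q (averaged_rule r q \<nu> \<sigma> n) (joint_law n r q \<nu> \<sigma> n)"
    by (auto simp: transition_gen_def joint_law_def path_law_eq_path_gen averaged_rule_def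
      bind_assoc_pmf intro!: bind_pmf_cong)
  finally show ?thesis .
qed

lemma joint_law_induced_policy:
  fixes r :: "'e::finite \<Rightarrow> 'a::finite \<Rightarrow> real"
  shows "joint_law (Suc n) r q \<nu> (induced_policy r \<pi>) (Suc n) =
    transition_gen r q (\<pi> n) (joint_law n r q \<nu> (induced_policy r \<pi>) n)"
  by (subst joint_law_Suc) (simp add: transition_gen_def joint_law_def path_law_eq_path_gen
    bind_map_pmf induced_policy_def)

lemma transition_joint_law:
  fixes r :: "'e::finite \<Rightarrow> 'a::finite \<Rightarrow> real"
  assumes "n \<le> N"
  shows "transition (reward_values N r g) r q \<pi> (joint_law n r q \<nu> \<sigma> n) =
    transition_gen r q \<pi> (joint_law n r q \<nu> \<sigma> n)"
  by (intro transition_eq_transition_gen finite_reward_values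
    lifted_states_dists_on[OF joint_law_in_lifted_states[OF assms]])

section \<open>Values of policies and the value of the lifted problem\<close>

text \<open>
  Each step of a policy is a step of the lifted problem with some action, over all of which \<open>J\<^sub>n\<close>
  takes the supremum. So \<open>J\<close> does not increase along the joint laws of the policy.
\<close>

lemma H_joint_law_le_J:
  fixes r :: "'e::finite \<Rightarrow> 'a::finite \<Rightarrow> real"
  shows "ereal (H (joint_law N r q \<nu> \<sigma> N)) \<le> J (reward_values N r g) N r q H 0 (initial_dist \<nu>)"
proof -
  let ?J = "J (reward_values N r g) N r q H"
  have "?J N (joint_law N r q \<nu> \<sigma> N) \<le> ?J n (joint_law n r q \<nu> \<sigma> n)" if "n \<le> N" for n
    using that
  proof (induction n rule: inc_induct)
    case (step n)
    note step.IH
    also have "?J (Suc n) (joint_law (Suc n) r q \<nu> \<sigma> (Suc n)) \<le> ?J n (joint_law n r q \<nu> \<sigma> n)"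
      using step.hyps
      by (simp add: joint_law_Suc_averaged transition_joint_law[of n N r g, symmetric] J_upper)
    finally show ?case .
  qed simp
  from this[of 0] show ?thesis
    by (simp add: joint_law_0 J.simps[of _ N _ _ _ N])
qed

text \<open>
  Links the recursively defined optimal trajectory to the actual process under the induced policy;
  in particular the trajectory stays where maximizers are required to be maximal.
\<close>

lemma optimal_state_eq_joint_law:
  fixes r :: "'e::finite \<Rightarrow> 'a::finite \<Rightarrow> real"
  assumes "n \<le> N"
  shows "optimal_state (reward_values N r g) r q \<nu> f n =
    joint_law n r q \<nu> (induced_policy r (optimal_action (reward_values N r g) r q \<nu> f)) n"
  using assms
proof (induction n)
  case 0
  show ?case by (simp add: joint_law_0)
next
  case (Suc n)
  then show ?case
    by (simp add: joint_law_induced_policy transition_joint_law[of n N r g, symmetric] optimal_action_def)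
qed

text \<open>
  A maximizing action turns the supremum in the recursion into an equality, so \<open>J\<^sub>n(F\<^sub>n)\<close> does not
  depend on \<open>n\<close> along the optimal trajectory, and its last value is \<open>H\<close> of the joint law at time \<open>N\<close>.
\<close>

lemma J_eq_H_induced_policy:
  fixes r :: "'e::finite \<Rightarrow> 'a::finite \<Rightarrow> real" and \<nu> :: "'e pmf"
  assumes f: "maximizers (reward_values N r g) N r q H f"
  defines "\<sigma> \<equiv> induced_policy r (optimal_action (reward_values N r g) r q \<nu> f)"
  shows "J (reward_values N r g) N r q H 0 (initial_dist \<nu>) = ereal (H (joint_law N r q \<nu> \<sigma> N))"
proof -
  let ?S = "reward_values N r g"
  have "J ?S N r q H 0 (initial_dist \<nu>) = J ?S N r q H n (optimal_state ?S r q \<nu> f n)"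
    if "n \<le> N" for n
    using that
  proof (induction n)
    case (Suc n)
    have "optimal_state ?S r q \<nu> f n \<in> lifted_states ?S N r q n"
      using Suc.prems by (simp add: optimal_state_eq_joint_law[of n N] joint_law_in_lifted_states)
    with Suc J_maximizers[OF f, of n] show ?case by simp
  qed simp
  from this[of N] show ?thesis
    by (simp add: \<sigma>_def optimal_state_eq_joint_law[of N N] J.simps[of _ N _ _ _ N])
qed

theorem theorem2p4:
  fixes N :: nat
    and r :: "'e::finite \<Rightarrow> 'a::finite \<Rightarrow> real"
    and g :: "'e \<Rightarrow> real"
    and q :: "'e \<Rightarrow> 'a \<Rightarrow> 'e pmf"
    and \<nu> :: "'e pmf"
    and S :: "real set"
    and H :: "('e \<times> real) pmf \<Rightarrow> real"
  assumes S: "S = reward_values N r g"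
    and C1: "usc_dists S H"
  shows
    "J S N r q H 0 (initial_dist \<nu>) = (SUP \<sigma>. ereal (H (joint_law N r q \<nu> \<sigma> N))) \<and>
     (\<exists>f. maximizers S N r q H f) \<and>
     (\<forall>f. maximizers S N r q H f \<longrightarrow>
        is_arg_max (\<lambda>\<sigma>. H (joint_law N r q \<nu> \<sigma> N)) (\<lambda>_. True)
          (induced_policy r (optimal_action S r q \<nu> f)))"
proof (intro conjI allI impI)
  have upper: "ereal (H (joint_law N r q \<nu> \<sigma> N)) \<le> J S N r q H 0 (initial_dist \<nu>)" for \<sigma>
    unfolding S by (rule H_joint_law_le_J)
  have attained: "J S N r q H 0 (initial_dist \<nu>) =
      ereal (H (joint_law N r q \<nu> (induced_policy r (optimal_action S r q \<nu> f)) N))"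
    if "maximizers S N r q H f" for f
    using J_eq_H_induced_policy that unfolding S by blast
  show ex: "\<exists>f. maximizers S N r q H f"
    using C1 by (intro maximizers_exist) (simp_all add: S finite_reward_values)
  show "J S N r q H 0 (initial_dist \<nu>) = (SUP \<sigma>. ereal (H (joint_law N r q \<nu> \<sigma> N)))"
  proof (rule antisym)
    obtain f where "maximizers S N r q H f" using ex by blast
    then show "J S N r q H 0 (initial_dist \<nu>) \<le> (SUP \<sigma>. ereal (H (joint_law N r q \<nu> \<sigma> N)))"
      by (auto simp: attained intro: SUP_upper)
    show "(SUP \<sigma>. ereal (H (joint_law N r q \<nu> \<sigma> N))) \<le> J S N r q H 0 (initial_dist \<nu>)"
      by (intro SUP_least upper)
  qed
  fix f assume "maximizers S N r q H f"
  then have "H (joint_law N r q \<nu> \<sigma> N)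
      \<le> H (joint_law N r q \<nu> (induced_policy r (optimal_action S r q \<nu> f)) N)" for \<sigma>
    using upper[of \<sigma>] attained[of f] by simp
  then show "is_arg_max (\<lambda>\<sigma>. H (joint_law N r q \<nu> \<sigma> N)) (\<lambda>_. True)
      (induced_policy r (optimal_action S r q \<nu> f))"
    by (auto simp: is_arg_max_linorder)
qed

end
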